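(* Let $k\geqslant 2$ and $m\geqslant 1$ be integers. If $mk$ is divisible by the square of an odd integer greater than $1$ or $mk$ is divisible by $8$, and if $$m\geqslant \frac{(5k^2-19k+20)^2}{4k},$$ then the generalized friendship graph $F(k,m)$ is not maximal.
   Context: All graphs are finite and simple. The rank of a graph is the rank (over the reals) of its adjacency matrix. A graph is reduced if it has no isolated vertex and no two distinct vertices with the same set of neighbors. A reduced graph $G$ is maximal if it is not a proper induced subgraph of any reduced graph with the same rank as $G$ (equivalently, every reduced graph containing $G$ as a proper induced subgraph has a higher rank). The generalized friendship graph $F(k,m)$ is the graph on $mk+1$ vertices obtained by adding a new vertex to $m$ disjoint copies of the complete graph $K_k$ and joining it to all the vertices of these copies. *)

theory Defs
  imports "Graph_Theory.Pair_Digraph" "Graph_Theory.Digraph_Component"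
    "Jordan_Normal_Form.DL_Rank"
begin

text \<open>
  Finite simple graphs are represented by \<^locale>\<open>pair_graph\<close>: an edge is a pair of opposite arcs.
\<close>

definition neighbourhood :: "'a pair_pre_digraph \<Rightarrow> 'a \<Rightarrow> 'a set" where
  "neighbourhood G u = {v. (u, v) \<in> parcs G}"

text \<open>
  The vertices are listed in increasing order; any other order permutes rows and columns
  simultaneously and gives the same rank.
\<close>

definition adjacency_matrix :: "'a::linorder pair_pre_digraph \<Rightarrow> real mat" where
  "adjacency_matrix G =
    (let vs = sorted_list_of_set (pverts G); n = length vs
     in mat n n (\<lambda>(i, j). if (vs ! i, vs ! j) \<in> parcs G then 1 else 0))"

definition graph_rank :: "'a::linorder pair_pre_digraph \<Rightarrow> nat" where
  "graph_rank G = vec_space.rank (card (pverts G)) (adjacency_matrix G)"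

definition reduced :: "'a pair_pre_digraph \<Rightarrow> bool" where
  "reduced G \<longleftrightarrow> pair_graph G \<and>
     (\<forall>v \<in> pverts G. neighbourhood G v \<noteq> {}) \<and>
     (\<forall>u \<in> pverts G. \<forall>v \<in> pverts G. u \<noteq> v \<longrightarrow> neighbourhood G u \<noteq> neighbourhood G v)"

text \<open>
  All graphs have vertices in \<^typ>\<open>nat\<close>. As \<^typ>\<open>nat\<close> is infinite, every finite graph having an isomorphic
  copy of \<open>G\<close> as an induced subgraph is isomorphic to some \<open>H\<close> on \<^typ>\<open>nat\<close> that has \<open>G\<close> itself as an
  induced subgraph, so ranging over such \<open>H\<close> loses nothing.
\<close>

definition maximal_reduced :: "nat pair_pre_digraph \<Rightarrow> bool" where
  "maximal_reduced G \<longleftrightarrow> reduced G \<and>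
     \<not> (\<exists>H :: nat pair_pre_digraph. reduced H \<and> graph_rank H = graph_rank G \<and>
           induced_subgraph (with_proj G) (with_proj H) \<and> G \<noteq> H)"

text \<open>The added vertex is \<open>0\<close>; the copy of \<open>K\<^sub>k\<close> with index \<open>c < m\<close> has vertices \<open>c * k + 1, \<dots>, c * k + k\<close>.\<close>

definition clique_copy :: "nat \<Rightarrow> nat \<Rightarrow> nat set" where
  "clique_copy k c = {c * k + 1 .. c * k + k}"

definition generalized_friendship_graph :: "nat \<Rightarrow> nat \<Rightarrow> nat pair_pre_digraph" where
  "generalized_friendship_graph k m =
    \<lparr> pverts = {0} \<union> (\<Union>c<m. clique_copy k c),
      parcs = (\<Union>c<m. {(u, v). u \<in> clique_copy k c \<and> v \<in> clique_copy k c \<and> u \<noteq> v}) \<union>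
              (\<Union>c<m. {0} \<times> clique_copy k c \<union> clique_copy k c \<times> {0}) \<rparr>"

lemma clique_copy_disjoint:
  assumes "u \<in> clique_copy k c" "u \<in> clique_copy k d"
  shows "c = d"
proof -
  have "e = (u - 1) div k" if "u \<in> clique_copy k e" for e
    using that by (intro div_nat_eqI[symmetric]) (auto simp: clique_copy_def algebra_simps)
  with assms show ?thesis by metis
qed

lemma pverts_generalized_friendship_graph:
  "pverts (generalized_friendship_graph k m) = {0..m * k}"
proof -
  have "(\<Union>c<m. clique_copy k c) = {1..m * k}"
    by (induction m) (auto simp: lessThan_Suc clique_copy_def)
  then show ?thesis by (auto simp: generalized_friendship_graph_def)
qed

lemma pair_graph_generalized_friendship_graph:
  "pair_graph (generalized_friendship_graph k m)"
proof -
  let ?G = "generalized_friendship_graph k m"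
  have sub: "parcs ?G \<subseteq> pverts ?G \<times> pverts ?G"
    by (auto simp: generalized_friendship_graph_def)
  have fin: "finite (pverts ?G)"
    by (simp add: pverts_generalized_friendship_graph)
  show ?thesis
  proof unfold_locales
    show "finite (parcs ?G)"
      using finite_subset[OF sub] fin by blast
    show "symmetric (with_proj ?G)"
      by (auto simp: symmetric_def sym_def generalized_friendship_graph_def)
    show "fst e \<noteq> snd e" if "e \<in> parcs ?G" for e
      using that by (auto simp: generalized_friendship_graph_def clique_copy_def)
  qed (use sub fin in auto)
qed

lemma reduced_generalized_friendship_graph:
  assumes "2 \<le> k" "1 \<le> m"
  shows "reduced (generalized_friendship_graph k m)"
proof -
  let ?G = "generalized_friendship_graph k m"
  have nb0: "neighbourhood ?G 0 = (\<Union>c<m. clique_copy k c)"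
    by (auto simp: neighbourhood_def generalized_friendship_graph_def clique_copy_def)
  have nb: "neighbourhood ?G u = {0} \<union> (clique_copy k c - {u})"
    if "u \<in> clique_copy k c" "c < m" for u c
    using that clique_copy_disjoint[of _ k _ c]
    by (auto simp: neighbourhood_def generalized_friendship_graph_def)
       (auto simp: clique_copy_def)
  have mem: "u = 0 \<or> (\<exists>c<m. u \<in> clique_copy k c)" if "u \<in> pverts ?G" for u
    using that by (auto simp: generalized_friendship_graph_def)
  have not0: "0 \<notin> clique_copy k c" for c
    by (simp add: clique_copy_def)
  have "1 \<in> neighbourhood ?G 0"
    using assms unfolding nb0 by (auto simp: clique_copy_def intro!: bexI[of _ 0])
  then have iso: "neighbourhood ?G u \<noteq> {}" if "u \<in> pverts ?G" for u
    using mem[OF that] nb by auto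
  have zero: "0 \<in> neighbourhood ?G u \<longleftrightarrow> u \<noteq> 0" if "u \<in> pverts ?G" for u
    using mem[OF that] nb nb0 not0 by (cases "u = 0") auto
  have twins: "u = v"
    if uv: "u \<in> pverts ?G" "v \<in> pverts ?G" and eq: "neighbourhood ?G u = neighbourhood ?G v" for u v
  proof (cases "u = 0 \<or> v = 0")
    case True
    then show ?thesis
      using zero[OF uv(1)] zero[OF uv(2)] eq by auto
  next
    case False
    then obtain c d where c: "c < m" "u \<in> clique_copy k c" and d: "d < m" "v \<in> clique_copy k d"
      using mem[OF uv(1)] mem[OF uv(2)] by blast
    have E: "clique_copy k c - {u} = clique_copy k d - {v}"
    proof -
      have "{0} \<union> (clique_copy k c - {u}) = {0} \<union> (clique_copy k d - {v})"
        using eq nb[OF c(2,1)] nb[OF d(2,1)] by simp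
      then show ?thesis
        using not0[of c] not0[of d] by (simp add: insert_ident)
    qed
    have "card (clique_copy k c - {u}) \<noteq> 0"
      using c assms by (simp add: clique_copy_def)
    then obtain w where w: "w \<in> clique_copy k c - {u}"
      by (metis all_not_in_conv card.empty)
    with E have "w \<in> clique_copy k d"
      by simp
    with w have "c = d"
      using clique_copy_disjoint[of w k c d] by simp
    then show ?thesis
      using E c(2) d(2) by (metis Diff_iff singleton_iff)
  qed
  show ?thesis
    unfolding reduced_def
    using pair_graph_generalized_friendship_graph iso twins by blast
qed

end

theory Submission
  imports Defs "Jordan_Normal_Form.DL_Rank_Submatrix"
begin

text \<open>
  The adjacency matrix \<open>A\<close> of \<open>F(k, m)\<close> is nonsingular, so joining a new vertex to a vertex set \<open>S\<close> with
  indicator vector \<open>b\<close> keeps the rank exactly when \<open>b\<^sup>T A\<inverse> b = 0\<close>. To refute maximality it is enough to find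
  one such \<open>S\<close> that is neither empty nor the neighbourhood of an old vertex.

  Take \<open>S\<close> without the central vertex, meeting the clique \<open>c\<close> in \<open>\<beta> c\<close> vertices. By symmetry the solution of
  \<open>A x = b\<close> is explicit, and \<open>b\<^sup>T x = 0\<close> becomes the equation \<open>B\<^sup>2 = m k D\<close> between the sums
  \<open>B = \<Sum>\<^sub>c \<beta> c\<close> and \<open>D = \<Sum>\<^sub>c \<beta> c (\<beta> c - (k - 1))\<close>. If moreover \<open>0 < B < m k\<close>, then \<open>S\<close> is neither empty
  nor the neighbourhood of the centre, and it differs from the other neighbourhoods because these
  contain the centre. This is lemma \<open>friendship_not_maximal_if_clique_counts\<close>.

  The arithmetic hypothesis provides a factorization \<open>m k = d\<^sup>2 e\<close> with \<open>d > 1\<close>. Then \<open>B = d e j\<close> and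
  \<open>D = e j\<^sup>2\<close> satisfy the equation for every \<open>j\<close>, and \<open>0 < j < d\<close> gives the bounds on \<open>B\<close>. What remains
  is to realize the pair \<open>(B, D)\<close> by \<open>m\<close> numbers \<open>\<beta> c \<le> k\<close>. A clique with \<open>\<beta> c = k\<close> adds \<open>k\<close> to \<open>D\<close>, one
  with \<open>\<beta> c = k - 1\<close> or \<open>\<beta> c = 0\<close> adds nothing, and one with \<open>\<beta> c = 1\<close> or \<open>\<beta> c = k - 2\<close> subtracts
  \<open>k - 2\<close>. The first two values do most of the work. Fewer than \<open>k\<close> cliques with value \<open>1\<close> and fewer than
  \<open>k - 1\<close> with value \<open>k - 2\<close> fix the residues modulo \<open>k\<close> and \<open>k - 1\<close>; the only obstruction to doing so is
  a parity condition, which holds because \<open>d\<close> is odd or \<open>e\<close> is even. With \<open>j\<close> as close as possible to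
  \<open>d / 2\<close>, the number \<open>B - D = e j (d - j)\<close> of vertices left for the value \<open>k - 1\<close> before the correction
  is at least \<open>2 m k / 9\<close>, and the lower bound on \<open>m\<close> makes this large enough to pay for the correction
  (lemma \<open>clique_count_multiplicities\<close>).
\<close>

section \<open>Adding a vertex without changing the rank\<close>

definition add_vertex :: "'a pair_pre_digraph \<Rightarrow> 'a \<Rightarrow> 'a set \<Rightarrow> 'a pair_pre_digraph" where
  "add_vertex G w S = \<lparr> pverts = insert w (pverts G), parcs = parcs G \<union> {w} \<times> S \<union> S \<times> {w} \<rparr>"

lemma pair_graph_add_vertex:
  assumes "pair_graph G" "S \<subseteq> pverts G" "w \<notin> pverts G"
  shows "pair_graph (add_vertex G w S)"
proof -
  interpret pair_graph G by fact
  have sub: "parcs (add_vertex G w S) \<subseteq> pverts (add_vertex G w S) \<times> pverts (add_vertex G w S)"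
    using assms(2) in_arcsD1 in_arcsD2 by (auto simp: add_vertex_def)
  have fin: "finite (pverts (add_vertex G w S))"
    by (simp add: add_vertex_def pair_finite_verts)
  show ?thesis
  proof unfold_locales
    show "finite (parcs (add_vertex G w S))"
      using finite_subset[OF sub] fin by blast
    show "symmetric (with_proj (add_vertex G w S))"
      using pair_sym_arcs by (auto simp: symmetric_def sym_def add_vertex_def)
    show "fst e \<noteq> snd e" if "e \<in> parcs (add_vertex G w S)" for e
      using that pair_no_loops assms(2,3) by (auto simp: add_vertex_def)
  qed (use sub fin in auto)
qed

lemma induced_subgraph_add_vertex:
  assumes "pair_graph G" "S \<subseteq> pverts G" "w \<notin> pverts G"
  shows "induced_subgraph (with_proj G) (with_proj (add_vertex G w S))"
proof -
  interpret G: pair_graph G by fact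
  interpret H: pair_graph "add_vertex G w S" by (rule pair_graph_add_vertex[OF assms])
  show ?thesis
    unfolding induced_subgraph_def subgraph_def
    using assms(2,3) G.wf_digraph_axioms H.wf_digraph_axioms G.in_arcsD1 G.in_arcsD2
    by (auto simp: add_vertex_def compatible_def)
qed

text \<open>
  Restricted to the old vertices, the neighbourhood of an old vertex is unchanged and that of the
  new one is \<open>S\<close>, so any twins in the larger graph already show up in this restriction.
\<close>

lemma reduced_add_vertex:
  assumes "reduced G" "S \<subseteq> pverts G" "w \<notin> pverts G" "S \<noteq> {}"
    and new: "\<And>u. u \<in> pverts G \<Longrightarrow> neighbourhood G u \<noteq> S"
  shows "reduced (add_vertex G w S)"
proof -
  have pg: "pair_graph G" using assms(1) by (simp add: reduced_def)
  interpret pair_graph G by (rule pg)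
  have sub: "neighbourhood G u \<subseteq> pverts G" for u
    using in_arcsD2 by (auto simp: neighbourhood_def)
  have old: "neighbourhood (add_vertex G w S) u \<inter> pverts G = neighbourhood G u"
    if "u \<in> pverts G" for u
    using that sub[of u] assms(2,3) by (auto simp: neighbourhood_def add_vertex_def)
  have w: "neighbourhood (add_vertex G w S) w \<inter> pverts G = S"
    using assms(2,3) in_arcsD1 by (auto simp: neighbourhood_def add_vertex_def)
  have V: "pverts (add_vertex G w S) = insert w (pverts G)"
    by (simp add: add_vertex_def)
  have iso: "\<forall>v\<in>pverts G. neighbourhood G v \<noteq> {}"
    and tw: "\<forall>u\<in>pverts G. \<forall>v\<in>pverts G. u \<noteq> v \<longrightarrow> neighbourhood G u \<noteq> neighbourhood G v"
    using assms(1) by (auto simp: reduced_def)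
  have 1: "neighbourhood (add_vertex G w S) v \<noteq> {}" if "v \<in> insert w (pverts G)" for v
    using that old[of v] w iso \<open>S \<noteq> {}\<close> by blast
  have 2: "u = v" if "u \<in> insert w (pverts G)" "v \<in> insert w (pverts G)"
    "neighbourhood (add_vertex G w S) u = neighbourhood (add_vertex G w S) v" for u v
    using that old[of u] old[of v] w tw new[of u] new[of v]
    by (metis insert_iff)
  show ?thesis
    unfolding reduced_def V
    using pair_graph_add_vertex[OF pg assms(2,3)] 1 2 by blast
qed

lemma adjacency_matrix_lessThan:
  assumes "pverts G = {..<N}"
  shows "adjacency_matrix G = mat N N (\<lambda>(i, j). if (i, j) \<in> parcs G then 1 else 0)"
proof -
  have "sorted_list_of_set (pverts G) = [0..<N]"
    unfolding assms by (simp add: lessThan_atLeast0)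
  then show ?thesis
    by (auto simp: adjacency_matrix_def Let_def intro!: eq_matI)
qed

lemma adjacency_matrix_mult_vec_index:
  assumes "pverts G = {..<N}" "pair_graph G" "v \<in> carrier_vec N" "i < N"
  shows "(adjacency_matrix G *\<^sub>v v) $ i = (\<Sum>j\<in>neighbourhood G i. v $ j)"
proof -
  interpret pair_graph G by fact
  have sub: "neighbourhood G i \<subseteq> {0..<N}"
    using in_arcsD2 assms(1) by (auto simp: neighbourhood_def)
  have "(adjacency_matrix G *\<^sub>v v) $ i = (\<Sum>j\<in>{0..<N}. if j \<in> neighbourhood G i then v $ j else 0)"
    using assms(3,4)
    by (auto simp: adjacency_matrix_lessThan[OF assms(1)] scalar_prod_def neighbourhood_def
        intro!: sum.cong)
  also have "\<dots> = (\<Sum>j\<in>neighbourhood G i. v $ j)"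
    using sub by (simp add: sum.inter_restrict[symmetric] Int_absorb1)
  finally show ?thesis .
qed

text \<open>
  The kernel of the adjacency matrix is trivial; vectors are functions on the vertices, which makes
  the condition a statement about sums over neighbourhoods.
\<close>

definition nonsingular :: "nat pair_pre_digraph \<Rightarrow> bool" where
  "nonsingular G \<longleftrightarrow> (\<forall>v :: nat \<Rightarrow> real. (\<forall>i\<in>pverts G. (\<Sum>j\<in>neighbourhood G i. v j) = 0)
      \<longrightarrow> (\<forall>i\<in>pverts G. v i = 0))"

lemma det_adjacency_matrix_nonzero_iff_nonsingular:
  assumes "pverts G = {..<N}" "pair_graph G"
  shows "det (adjacency_matrix G) \<noteq> 0 \<longleftrightarrow> nonsingular G"
proof -
  interpret pair_graph G by fact
  have A: "adjacency_matrix G \<in> carrier_mat N N"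
    by (simp add: adjacency_matrix_lessThan[OF assms(1)])
  have sub: "neighbourhood G i \<subseteq> {..<N}" for i
    using in_arcsD2 assms(1) by (auto simp: neighbourhood_def)
  have dimA: "dim_row (adjacency_matrix G) = N"
    using A by simp
  have iff: "adjacency_matrix G *\<^sub>v v = 0\<^sub>v N \<longleftrightarrow> (\<forall>i<N. (\<Sum>j\<in>neighbourhood G i. v $ j) = 0)"
    if "v \<in> carrier_vec N" for v
    using adjacency_matrix_mult_vec_index[OF assms that]
    by (auto simp: vec_eq_iff dimA)
  show ?thesis
  proof
    assume det: "det (adjacency_matrix G) \<noteq> 0"
    show "nonsingular G"
      unfolding nonsingular_def
    proof (intro allI impI)
      fix v :: "nat \<Rightarrow> real"
      assume v: "\<forall>i\<in>pverts G. (\<Sum>j\<in>neighbourhood G i. v j) = 0"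
      have "(\<Sum>j\<in>neighbourhood G i. vec N v $ j) = (\<Sum>j\<in>neighbourhood G i. v j)" for i
        using sub[of i] by (intro sum.cong) auto
      then have "adjacency_matrix G *\<^sub>v vec N v = 0\<^sub>v N"
        using v assms(1) by (subst iff[OF vec_carrier]) auto
      then have "vec N v = 0\<^sub>v N"
        using det det_0_iff_vec_prod_zero_field[OF A] vec_carrier[of N v] by blast
      then show "\<forall>i\<in>pverts G. v i = 0"
        using assms(1) by (auto simp: vec_eq_iff)
    qed
  next
    assume ns: "nonsingular G"
    show "det (adjacency_matrix G) \<noteq> 0"
    proof
      assume "det (adjacency_matrix G) = 0"
      then obtain v where v: "v \<in> carrier_vec N" "v \<noteq> 0\<^sub>v N" "adjacency_matrix G *\<^sub>v v = 0\<^sub>v N"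
        using det_0_iff_vec_prod_zero_field[OF A] by auto
      then have "\<forall>i<N. v $ i = 0"
        using ns iff[OF v(1)] by (auto simp: nonsingular_def assms(1))
      then show False
        using v(1,2) by (auto simp: vec_eq_iff)
    qed
  qed
qed

lemma graph_rank_nonsingular:
  assumes "pverts G = {..<N}" "pair_graph G" "nonsingular G"
  shows "graph_rank G = N"
proof -
  have A: "adjacency_matrix G \<in> carrier_mat N N"
    by (simp add: adjacency_matrix_lessThan[OF assms(1)])
  then show ?thesis
    using det_adjacency_matrix_nonzero_iff_nonsingular[OF assms(1,2)] assms(1,3)
    by (simp add: graph_rank_def vec_space.det_rank_iff)
qed

lemma pick_lessThan: "i < N \<Longrightarrow> pick {..<N} i = i"
proof (induction i)
  case 0
  then show ?case by (auto simp: Least_equality)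
next
  case (Suc i)
  then show ?case by (auto intro!: Least_equality)
qed

text \<open>
  The rank of the larger graph is at least \<open>N\<close> because the matrix of \<open>G\<close> is a nonzero minor, and less
  than \<open>N + 1\<close> because the solution \<open>x\<close> of \<open>A x = b\<close>, extended by \<open>-1\<close> at the new vertex, lies in the
  kernel: on the old rows by the choice of \<open>x\<close>, on the new row by \<open>b\<^sup>T x = 0\<close>.
\<close>

lemma graph_rank_add_vertex:
  fixes x :: "nat \<Rightarrow> real"
  assumes V: "pverts G = {..<N}" and G: "pair_graph G" and ns: "nonsingular G"
    and S: "S \<subseteq> {..<N}"
    and sol: "\<And>i. i < N \<Longrightarrow> (\<Sum>j\<in>neighbourhood G i. x j) = (if i \<in> S then 1 else 0)"
    and orth: "(\<Sum>j\<in>S. x j) = 0"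
  shows "graph_rank (add_vertex G N S) = N"
proof -
  let ?H = "add_vertex G N S"
  have VH: "pverts ?H = {..<Suc N}"
    by (simp add: add_vertex_def V lessThan_Suc)
  have H: "pair_graph ?H"
    using pair_graph_add_vertex[OF G] S V by simp
  interpret pair_graph G by (rule G)
  have sub: "neighbourhood G i \<subseteq> {..<N}" for i
    using in_arcsD2 V by (auto simp: neighbourhood_def)
  have nbN: "neighbourhood ?H N = S"
    using S in_arcsD1[of N] V by (auto simp: neighbourhood_def add_vertex_def)
  have nb: "neighbourhood ?H i = (if i \<in> S then insert N (neighbourhood G i) else neighbourhood G i)"
    if "i < N" for i
    using that S by (auto simp: neighbourhood_def add_vertex_def)
  define A where "A = adjacency_matrix ?H"
  have A: "A \<in> carrier_mat (Suc N) (Suc N)"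
    by (simp add: A_def adjacency_matrix_lessThan[OF VH])
  define y where "y = x(N := -1)"
  have yx: "(\<Sum>j\<in>T. y j) = (\<Sum>j\<in>T. x j)" if "T \<subseteq> {..<N}" for T
    using that by (intro sum.cong) (auto simp: y_def)
  have "(\<Sum>j\<in>neighbourhood ?H i. y j) = 0" if "i < Suc N" for i
  proof (cases "i = N")
    case True
    then show ?thesis using nbN yx[OF S] orth by simp
  next
    case False
    then have "i < N" using that by simp
    moreover have "N \<notin> neighbourhood G i" "finite (neighbourhood G i)"
      using sub[of i] finite_subset by auto
    ultimately show ?thesis
      using nb[of i] yx[OF sub[of i]] sol[of i] by (auto simp: y_def)
  qed
  moreover have "y N \<noteq> 0" by (simp add: y_def)
  ultimately have "\<not> nonsingular ?H"
    unfolding nonsingular_def VH by (metis lessI lessThan_iff)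
  then have "det A = 0"
    using det_adjacency_matrix_nonzero_iff_nonsingular[OF VH H] A_def by simp
  then have "vec_space.rank (Suc N) A \<noteq> Suc N"
    using vec_space.det_rank_iff[OF A] by simp
  moreover have "vec_space.rank (Suc N) A \<le> Suc N"
    by (rule vec_space.rank_le_nc[OF A])
  moreover have "N \<le> vec_space.rank (Suc N) A"
  proof -
    have c: "{a. a < Suc N \<and> a < N} = {..<N}" by auto
    have "submatrix A {..<N} {..<N} = adjacency_matrix G"
    proof (rule eq_matI)
      show "dim_row (submatrix A {..<N} {..<N}) = dim_row (adjacency_matrix G)"
        "dim_col (submatrix A {..<N} {..<N}) = dim_col (adjacency_matrix G)"
        using A by (simp_all add: dim_submatrix c adjacency_matrix_lessThan[OF V])
      fix i j assume "i < dim_row (adjacency_matrix G)" "j < dim_col (adjacency_matrix G)"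
      then have ij: "i < N" "j < N" by (simp_all add: adjacency_matrix_lessThan[OF V])
      then have "submatrix A {..<N} {..<N} $$ (i, j) = A $$ (i, j)"
        using A by (simp add: submatrix_index c pick_lessThan)
      also have "\<dots> = adjacency_matrix G $$ (i, j)"
        using ij S unfolding A_def adjacency_matrix_lessThan[OF V] adjacency_matrix_lessThan[OF VH]
        by (auto simp: add_vertex_def)
      finally show "submatrix A {..<N} {..<N} $$ (i, j) = adjacency_matrix G $$ (i, j)" .
    qed
    then have "det (submatrix A {..<N} {..<N}) \<noteq> 0"
      using ns det_adjacency_matrix_nonzero_iff_nonsingular[OF V G] by simp
    from vec_space.rank_gt_minor[OF A this] show ?thesis
      by (simp add: c)
  qed
  ultimately show ?thesis
    by (simp add: graph_rank_def VH A_def)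
qed

section \<open>Extending generalized friendship graphs by a vertex\<close>

lemma neighbourhood_friendship_centre:
  "neighbourhood (generalized_friendship_graph k m) 0 = (\<Union>c<m. clique_copy k c)"
  by (auto simp: neighbourhood_def generalized_friendship_graph_def clique_copy_def)

lemma neighbourhood_friendship_clique:
  assumes "u \<in> clique_copy k c" "c < m"
  shows "neighbourhood (generalized_friendship_graph k m) u = insert 0 (clique_copy k c - {u})"
  using assms clique_copy_disjoint[of _ k _ c]
  by (auto simp: neighbourhood_def generalized_friendship_graph_def)
     (auto simp: clique_copy_def)

lemma friendship_vertex_cases:
  assumes "u \<in> pverts (generalized_friendship_graph k m)"
  obtains "u = 0" | c where "c < m" "u \<in> clique_copy k c"
  using assms by (auto simp: generalized_friendship_graph_def)

lemma zero_notin_clique_copy: "0 \<notin> clique_copy k c"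
  by (simp add: clique_copy_def)

lemma card_clique_copy: "card (clique_copy k c) = k"
  by (simp add: clique_copy_def)

lemma finite_clique_copy: "finite (clique_copy k c)"
  by (simp add: clique_copy_def)

lemma clique_copy_index:
  assumes "u \<in> clique_copy k c"
  shows "(u - 1) div k = c"
  using assms by (intro div_nat_eqI) (auto simp: clique_copy_def algebra_simps)

lemma sum_UN_clique_subsets:
  assumes "\<And>c. c < m \<Longrightarrow> T c \<subseteq> clique_copy k c"
  shows "(\<Sum>i\<in>(\<Union>c<m. T c). f i) = (\<Sum>c<m. \<Sum>i\<in>T c. f i)"
proof (rule sum.UNION_disjoint)
  show "\<forall>c\<in>{..<m}. finite (T c)"
    using assms finite_clique_copy finite_subset by (metis lessThan_iff)
  show "\<forall>c\<in>{..<m}. \<forall>d\<in>{..<m}. c \<noteq> d \<longrightarrow> T c \<inter> T d = {}"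
    using assms clique_copy_disjoint by blast
qed simp

lemma sum_neighbourhood_friendship_centre:
  "(\<Sum>j\<in>neighbourhood (generalized_friendship_graph k m) 0. v j)
    = (\<Sum>c<m. \<Sum>j\<in>clique_copy k c. v j)"
  unfolding neighbourhood_friendship_centre by (rule sum_UN_clique_subsets) (rule order_refl)

lemma sum_neighbourhood_friendship_clique:
  fixes v :: "nat \<Rightarrow> real"
  assumes "u \<in> clique_copy k c" "c < m"
  shows "(\<Sum>j\<in>neighbourhood (generalized_friendship_graph k m) u. v j)
    = v 0 + (\<Sum>j\<in>clique_copy k c. v j) - v u"
  using assms
  by (simp add: neighbourhood_friendship_clique zero_notin_clique_copy finite_clique_copy
      sum_diff1)

text \<open>
  The equation at a vertex \<open>u\<close> of a clique says that \<open>v u\<close> is \<open>v 0\<close> plus the sum of \<open>v\<close> over the clique.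
  Hence \<open>v\<close> is constant on each clique, with a value determined by \<open>v 0\<close> and so the same for all
  cliques. The equation at the centre makes this common value zero.
\<close>

lemma nonsingular_friendship:
  assumes "2 \<le> k" "1 \<le> m"
  shows "nonsingular (generalized_friendship_graph k m)"
  unfolding nonsingular_def
proof (intro allI impI)
  fix v :: "nat \<Rightarrow> real"
  let ?G = "generalized_friendship_graph k m"
  assume v: "\<forall>i\<in>pverts ?G. (\<Sum>j\<in>neighbourhood ?G i. v j) = 0"
  have in_V: "u \<in> pverts ?G" if "u \<in> clique_copy k c" "c < m" for u c
    using that by (auto simp: generalized_friendship_graph_def)
  have "0 \<in> pverts ?G" by (simp add: generalized_friendship_graph_def)
  then have sum0: "(\<Sum>c<m. \<Sum>j\<in>clique_copy k c. v j) = 0"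
    using v sum_neighbourhood_friendship_centre[of v k m] by simp
  define t where "t = - v 0 / (real k - 1)"
  have t: "v u = t" if "u \<in> clique_copy k c" "c < m" for u c
  proof -
    let ?s = "\<Sum>j\<in>clique_copy k c. v j"
    have eq: "v j = v 0 + ?s" if "j \<in> clique_copy k c" for j
      using v in_V[OF that \<open>c < m\<close>] sum_neighbourhood_friendship_clique[OF that \<open>c < m\<close>, of v]
      by simp
    have "?s = (\<Sum>j\<in>clique_copy k c. v 0 + ?s)"
      by (rule sum.cong[OF refl eq])
    then have "?s = real k * (v 0 + ?s)"
      by (simp add: card_clique_copy)
    then have "v u - v 0 = real k * v u"
      using eq[OF \<open>u \<in> clique_copy k c\<close>] by simp
    then show ?thesis
      using assms(1) by (simp add: t_def field_simps)
  qed
  have "(\<Sum>c<m. \<Sum>j\<in>clique_copy k c. v j) = (\<Sum>c<m. \<Sum>j\<in>clique_copy k c. t)"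
    using t by (intro sum.cong) auto
  then have "t = 0"
    using sum0 assms by (simp add: card_clique_copy)
  moreover have "v 0 = 0"
    using \<open>t = 0\<close> assms(1) by (simp add: t_def)
  ultimately show "\<forall>i\<in>pverts ?G. v i = 0"
    using t by (metis friendship_vertex_cases)
qed

text \<open>
  For \<open>S\<close> meeting the clique \<open>c\<close> in \<open>\<beta> c\<close> vertices, the equations at the vertices of that clique force
  its part of \<open>x\<close> to have the sum \<open>s c = (\<beta> c - k x\<^sub>0) / (k - 1)\<close>, and the equation at the centre forces
  \<open>x\<^sub>0 = B / (m k)\<close>. Multiplied by \<open>k - 1\<close>, the sum of \<open>x\<close> over \<open>S\<close> is then \<open>D - x\<^sub>0 B\<close>, where \<open>D\<close> is
  the sum on the right of \<open>balance\<close>.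
\<close>

lemma friendship_not_maximal_if_clique_counts:
  fixes \<beta> :: "nat \<Rightarrow> nat"
  assumes k: "2 \<le> k" and m: "1 \<le> m" and le: "\<And>c. c < m \<Longrightarrow> \<beta> c \<le> k"
    and B: "B = (\<Sum>c<m. real (\<beta> c))" and B_bounds: "0 < B" "B < real (m * k)"
    and balance: "B\<^sup>2 = real (m * k) * (\<Sum>c<m. real (\<beta> c) * (real (\<beta> c) - (real k - 1)))"
  shows "\<not> maximal_reduced (generalized_friendship_graph k m)"
proof -
  let ?G = "generalized_friendship_graph k m"
  let ?N = "Suc (m * k)"
  define T where "T c = {c * k + 1..c * k + \<beta> c}" for c
  define S where "S = (\<Union>c<m. T c)"
  have T_sub: "T c \<subseteq> clique_copy k c" if "c < m" for c
    using le[OF that] by (auto simp: T_def clique_copy_def)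
  have card_T: "card (T c) = \<beta> c" for c
    by (simp add: T_def)
  have card_S: "(\<Sum>i\<in>S. 1::real) = B"
    unfolding S_def B using T_sub by (subst sum_UN_clique_subsets) (auto simp: card_T)
  have S_T: "u \<in> S \<longleftrightarrow> u \<in> T c" if "u \<in> clique_copy k c" "c < m" for u c
  proof
    assume "u \<in> S"
    then obtain d where "d < m" "u \<in> T d" by (auto simp: S_def)
    then show "u \<in> T c"
      using that T_sub[of d] clique_copy_disjoint[of u k c d] by blast
  qed (use that(2) in \<open>auto simp: S_def\<close>)
  have S_0: "0 \<notin> S"
    by (auto simp: S_def T_def)
  have V: "pverts ?G = {..<?N}"
    by (auto simp: pverts_generalized_friendship_graph)
  have S_V: "S \<subseteq> pverts ?G"
    using T_sub by (auto simp: S_def generalized_friendship_graph_def)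
  have clique_S: "(\<Sum>j\<in>clique_copy k c. if j \<in> S then 1 else 0 :: real) = \<beta> c" if "c < m" for c
  proof -
    have "(\<Sum>j\<in>clique_copy k c. if j \<in> S then 1 else 0 :: real)
        = (\<Sum>j\<in>clique_copy k c. if j \<in> T c then 1 else 0)"
      using S_T that by (intro sum.cong) auto
    also have "\<dots> = (\<Sum>j\<in>clique_copy k c \<inter> T c. 1)"
      by (rule sum.inter_restrict[symmetric]) (rule finite_clique_copy)
    also have "clique_copy k c \<inter> T c = T c"
      using T_sub[OF that] by auto
    finally show ?thesis by (simp add: card_T)
  qed
  have pos: "real (m * k) > 0" "real k - 1 > 0"
    using k m by auto
  define x0 where "x0 = B / real (m * k)"
  define s where "s c = (real (\<beta> c) - real k * x0) / (real k - 1)" for c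
  define x where "x i = (if i = 0 then x0 else x0 + s ((i - 1) div k) - (if i \<in> S then 1 else 0))" for i
  have x_clique: "x u = x0 + s c - (if u \<in> S then 1 else 0)" if "u \<in> clique_copy k c" for u c
    using that clique_copy_index[OF that] zero_notin_clique_copy[of k c] by (auto simp: x_def)
  have x_sum: "(\<Sum>j\<in>clique_copy k c. x j) = s c" if "c < m" for c
  proof -
    have "(\<Sum>j\<in>clique_copy k c. x j)
        = (\<Sum>j\<in>clique_copy k c. x0 + s c - (if j \<in> S then 1 else 0))"
      using x_clique by (intro sum.cong) auto
    also have "\<dots> = real k * (x0 + s c) - \<beta> c"
      using clique_S[OF that] by (simp add: sum_subtractf card_clique_copy)
    also have "\<dots> = s c"
      using pos by (simp add: s_def field_simps)
    finally show ?thesis .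
  qed
  have sol: "(\<Sum>j\<in>neighbourhood ?G i. x j) = (if i \<in> S then 1 else 0)" if "i < ?N" for i
  proof -
    have "i \<in> pverts ?G" using that V by simp
    then show ?thesis
    proof (cases rule: friendship_vertex_cases)
      case 1
      have "(\<Sum>j\<in>neighbourhood ?G 0. x j) = (\<Sum>c<m. s c)"
        by (simp add: sum_neighbourhood_friendship_centre x_sum)
      also have "\<dots> = (B - real (m * k) * x0) / (real k - 1)"
        by (simp add: s_def B sum_subtractf flip: sum_divide_distrib)
      also have "\<dots> = 0"
        using k m by (simp add: x0_def)
      finally show ?thesis using 1 S_0 by simp
    next
      case (2 c)
      then show ?thesis
        using sum_neighbourhood_friendship_clique[OF 2(2,1), of x] x_sum[OF 2(1)]
          x_clique[OF 2(2)] by (simp add: x_def)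
    qed
  qed
  have orth: "(\<Sum>j\<in>S. x j) = 0"
  proof -
    have "(\<Sum>j\<in>S. x j) = (\<Sum>c<m. \<Sum>j\<in>T c. x j)"
      unfolding S_def by (rule sum_UN_clique_subsets) (rule T_sub)
    also have "\<dots> = (\<Sum>c<m. \<Sum>j\<in>T c. x0 + s c - 1)"
    proof (intro sum.cong refl)
      fix c j assume "c \<in> {..<m}" "j \<in> T c"
      then show "x j = x0 + s c - 1"
        using x_clique[of j c] T_sub[of c] S_T[of j c] by auto
    qed
    also have "\<dots> = (\<Sum>c<m. (real (\<beta> c) * (real (\<beta> c) - (real k - 1)) - x0 * real (\<beta> c)) / (real k - 1))"
      using pos by (intro sum.cong) (auto simp: card_T s_def field_simps)
    also have "\<dots> = ((\<Sum>c<m. real (\<beta> c) * (real (\<beta> c) - (real k - 1))) - x0 * B) / (real k - 1)"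
      by (simp add: B sum_subtractf sum_distrib_left flip: sum_divide_distrib)
    also have "(\<Sum>c<m. real (\<beta> c) * (real (\<beta> c) - (real k - 1))) = x0 * B"
      using balance pos by (simp add: x0_def field_simps power2_eq_square)
    finally show ?thesis by simp
  qed
  have G: "pair_graph ?G"
    by (rule pair_graph_generalized_friendship_graph)
  have ns: "nonsingular ?G"
    by (rule nonsingular_friendship[OF k m])
  have S_N: "S \<subseteq> {..<?N}" "?N \<notin> pverts ?G"
    using S_V V by auto
  have rank: "graph_rank (add_vertex ?G ?N S) = graph_rank ?G"
    using graph_rank_add_vertex[OF V G ns S_N(1) sol orth] graph_rank_nonsingular[OF V G ns] by simp
  have new: "neighbourhood ?G u \<noteq> S" if "u \<in> pverts ?G" for u
    using that
  proof (cases rule: friendship_vertex_cases)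
    case 1
    have "(\<Sum>i\<in>neighbourhood ?G 0. 1::real) = real (m * k)"
      by (simp only: sum_neighbourhood_friendship_centre) (simp add: card_clique_copy)
    then show ?thesis
      using 1 card_S B_bounds(2) by auto
  next
    case (2 c)
    then show ?thesis
      using neighbourhood_friendship_clique[OF 2(2,1)] S_0 by auto
  qed
  have "S \<noteq> {}"
    using card_S B_bounds(1) by auto
  then have "reduced (add_vertex ?G ?N S)"
    using reduced_add_vertex[OF reduced_generalized_friendship_graph[OF k m] S_V S_N(2) _ new] by simp
  moreover have "induced_subgraph (with_proj ?G) (with_proj (add_vertex ?G ?N S))"
    by (rule induced_subgraph_add_vertex[OF G S_V S_N(2)])
  moreover have "?G \<noteq> add_vertex ?G ?N S"
    using S_N(2) by (metis add_vertex_def insertI1 pair_pre_digraph.select_convs(1))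
  ultimately show ?thesis
    using rank unfolding maximal_reduced_def by blast
qed

section \<open>Choosing the numbers of neighbours in the cliques\<close>

text \<open>
  For odd \<open>N\<close> the inverse of \<open>2\<close> modulo \<open>N\<close> is \<open>(N + 1) / 2\<close>; for even \<open>N\<close> and \<open>c\<close> it suffices to halve
  everything, which also halves the range of the solution. The smaller range matters below for
  \<open>k = 3\<close>, where there is little room for corrections.
\<close>

lemma half_modulo:
  fixes N c :: int
  assumes "N > 0" "even N \<longrightarrow> even c"
  obtains y where "0 \<le> y" "y < N" "even N \<longrightarrow> 2 * y < N" "N dvd 2 * y - c"
proof (cases "even N")
  case True
  then obtain M c' where M: "N = 2 * M" "c = 2 * c'"
    using assms(2) by (auto elim!: evenE)
  have "M dvd c' mod M - c'"
    by (simp add: mod_eq_dvd_iff[symmetric])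
  then have "2 * M dvd 2 * (c' mod M - c')"
    by (rule mult_dvd_mono[OF dvd_refl])
  moreover have "0 \<le> c' mod M" "c' mod M < M"
    using assms(1) M by auto
  ultimately show ?thesis
    using that[of "c' mod M"] M by (simp add: algebra_simps)
next
  case False
  then obtain M where M: "N = 2 * M + 1"
    by (auto elim!: oddE)
  define y where "y = (c * (M + 1)) mod N"
  have "N dvd y - c * (M + 1)"
    by (simp add: y_def mod_eq_dvd_iff[symmetric])
  then have "N dvd 2 * (y - c * (M + 1)) + N * c"
    by (intro dvd_add dvd_mult dvd_triv_left) 
  also have "2 * (y - c * (M + 1)) + N * c = 2 * y - c"
    by (simp add: M algebra_simps)
  finally show ?thesis
    using that[of y] assms(1) False by (simp add: y_def)
qed

text \<open>
  The left-hand side is the number of vertices, of the \<open>s = B - D\<close> at hand for the value \<open>k - 1\<close>, that \<open>x\<close>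
  cliques with value \<open>1\<close> and \<open>y\<close> cliques with value \<open>k - 2\<close> use up. It is quadratic in \<open>k\<close>, whereas the
  lower bound on \<open>s\<close> is of degree four; only for \<open>k = 3\<close> is there need for the smaller range of \<open>y\<close> at odd \<open>k\<close>.
\<close>

lemma correction_bound:
  fixes k x y s :: int
  assumes k: "2 \<le> k" and s: "(5 * k\<^sup>2 - 19 * k + 20)\<^sup>2 \<le> 18 * s"
    and x: "0 \<le> x" "x < k"
    and y: "0 \<le> y" "y < k - 1" "even (k - 1) \<longrightarrow> 2 * y < k - 1"
  shows "(k - 1) * x + 2 * (k - 2) * y \<le> s"
proof -
  consider "k = 2" | "k = 3" | "k \<ge> 4" using k by linarith
  then show ?thesis
  proof cases
    case 1
    then show ?thesis using x y s by simp
  next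
    case 2
    then show ?thesis using x y s by simp
  next
    case 3
    define t where "t = 5 * k\<^sup>2 - 19 * k + 20"
    \<comment> \<open>In terms of \<open>r = k - 4\<close> all coefficients become nonnegative.\<close>
    obtain r where r: "k = r + 4" "r \<ge> 0" using 3 by (metis diff_add_cancel diff_ge_0_iff_ge)
    have t: "t = 5 * r\<^sup>2 + 21 * r + 24"
      by (simp add: t_def r power2_eq_square algebra_simps)
    have "t \<ge> 24" using r(2) by (simp add: t)
    then have "18 * t \<le> t * t" by (intro mult_right_mono) auto
    then have "t \<le> s" using s by (simp add: t_def power2_eq_square)
    moreover have "(k - 1) * x \<le> (k - 1) * (k - 1)"
      using x 3 by (intro mult_left_mono) auto
    moreover have "2 * (k - 2) * y \<le> 2 * (k - 2) * (k - 2)"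
      using y 3 by (intro mult_left_mono) auto
    moreover have "(k - 1) * (k - 1) + 2 * (k - 2) * (k - 2) \<le> t"
      using r(2) by (simp add: t r power2_eq_square algebra_simps)
    ultimately show ?thesis by linarith
  qed
qed

text \<open>
  Here \<open>p\<close>, \<open>q\<close>, \<open>x\<close>, \<open>y\<close> count the cliques with value \<open>k\<close>, \<open>k - 1\<close>, \<open>1\<close>, \<open>k - 2\<close>. The two equations determine
  \<open>p\<close> and \<open>q\<close> from \<open>x\<close> and \<open>y\<close>, namely \<open>k p = D + (k - 2)(x + y)\<close> and
  \<open>(k - 1) q = B - D - (k - 1) x - 2 (k - 2) y\<close>. As \<open>k - 2\<close> is \<open>-2\<close> modulo \<open>k\<close> and \<open>-1\<close> modulo \<open>k - 1\<close>,
  integrality of \<open>q\<close> prescribes \<open>2 y\<close> modulo \<open>k - 1\<close>, and integrality of \<open>p\<close> then prescribes \<open>2 x\<close> modulo \<open>k\<close>.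
  The assumption \<open>large\<close> yields \<open>q \<ge> 0\<close>, and \<open>room\<close> yields that \<open>m\<close> cliques suffice.
\<close>

lemma clique_count_multiplicities:
  fixes k m B D :: int
  assumes k: "2 \<le> k" and D: "0 \<le> D"
    and parity: "even k \<longrightarrow> even D" "odd k \<longrightarrow> even (B - D)"
    and large: "(5 * k\<^sup>2 - 19 * k + 20)\<^sup>2 \<le> 18 * (B - D)"
    and room: "(k - 2) * (B - D) \<le> (m * k) * (k - 1) - k * B + D"
  obtains p q x y where "0 \<le> p" "0 \<le> q" "0 \<le> x" "0 \<le> y" "p + q + x + y \<le> m"
    "p * k + q * (k - 1) + x + y * (k - 2) = B" "p * k - (x + y) * (k - 2) = D"
proof -
  obtain y where y: "0 \<le> y" "y < k - 1" "even (k - 1) \<longrightarrow> 2 * y < k - 1" "k - 1 dvd 2 * y - (D - B)"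
    using half_modulo[of "k - 1" "D - B"] k parity(2) by (auto simp: algebra_simps)
  obtain x where x: "0 \<le> x" "x < k" "k dvd 2 * x - (D - 2 * y)"
    using half_modulo[of k "D - 2 * y"] k parity(1) by auto
  have spare: "(k - 1) * x + 2 * (k - 2) * y \<le> B - D"
    by (rule correction_bound[OF k large x(1,2) y(1-3)])
  have "k dvd k * (x + y) - (2 * x - (D - 2 * y))"
    by (rule dvd_diff[OF dvd_triv_left x(3)])
  also have "k * (x + y) - (2 * x - (D - 2 * y)) = D + (k - 2) * (x + y)"
    by (simp add: algebra_simps)
  finally obtain p where p: "D + (k - 2) * (x + y) = k * p" by (elim dvdE)
  have "k - 1 dvd (2 * y - (D - B)) - (k - 1) * (x + 2 * y)"
    by (rule dvd_diff[OF y(4) dvd_triv_left])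
  also have "(2 * y - (D - B)) - (k - 1) * (x + 2 * y) = B - D - (k - 1) * x - 2 * (k - 2) * y"
    by (simp add: algebra_simps)
  finally obtain q where q: "B - D - (k - 1) * x - 2 * (k - 2) * y = (k - 1) * q" by (elim dvdE)
  have "0 \<le> k * p"
    unfolding p[symmetric] using k D x(1) y(1) by simp
  then have p0: "0 \<le> p" using k by (simp add: zero_le_mult_iff)
  have "0 \<le> (k - 1) * q"
    unfolding q[symmetric] using spare by simp
  then have q0: "0 \<le> q" using k by (simp add: zero_le_mult_iff)
  have "(k - 2) * (k - 1) * x + 2 * y \<le> (k - 2) * (B - D)"
  proof (cases "k = 2")
    case True
    then show ?thesis using y by simp
  next
    case False
    then have "1 \<le> (k - 2) * (k - 2)" using k
      by (metis diff_gt_0_iff_gt int_one_le_iff_zero_less mult_pos_pos order_le_less)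
    then have "2 * y \<le> 2 * ((k - 2) * (k - 2)) * y"
      using y(1) by (intro mult_right_mono) auto
    moreover have "(k - 2) * ((k - 1) * x + 2 * (k - 2) * y) \<le> (k - 2) * (B - D)"
      using spare k by (intro mult_left_mono) auto
    ultimately show ?thesis by (simp add: algebra_simps)
  qed
  then have "k * B - D + (k - 2) * (k - 1) * x + 2 * y \<le> k * (k - 1) * m"
    using room by (simp add: algebra_simps)
  moreover have "k * (k - 1) * (p + q + x + y) = k * B - D + (k - 2) * (k - 1) * x + 2 * y"
  proof -
    have "k * (k - 1) * (p + q + x + y) = (k - 1) * (k * p) + k * ((k - 1) * q) + k * (k - 1) * (x + y)"
      by (simp add: algebra_simps)
    also have "\<dots> = k * B - D + (k - 2) * (k - 1) * x + 2 * y"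
      unfolding p[symmetric] q[symmetric] by (simp add: algebra_simps)
    finally show ?thesis .
  qed
  ultimately have "k * (k - 1) * (p + q + x + y) \<le> k * (k - 1) * m"
    by simp
  moreover have "0 < k * (k - 1)" using k by simp
  ultimately have "p + q + x + y \<le> m"
    using mult_le_cancel_left_pos by blast
  then show ?thesis
    using that[of p q x y] p0 q0 x(1) y(1) p q by (simp add: algebra_simps)
qed

lemma exists_function_with_multiplicities:
  assumes "p + q + x + y \<le> m"
  obtains \<beta> :: "nat \<Rightarrow> nat" where "\<And>c. \<beta> c \<in> {a, b, u, v, 0}"
    "\<And>f :: nat \<Rightarrow> real. f 0 = 0 \<Longrightarrow>
       (\<Sum>c<m. f (\<beta> c)) = real p * f a + real q * f b + real x * f u + real y * f v"
proof -
  define xs where "xs = replicate p a @ replicate q b @ replicate x u @ replicate y v"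
  define \<beta> where "\<beta> c = (if c < length xs then xs ! c else 0)" for c
  have set: "set xs \<subseteq> {a, b, u, v}"
    by (auto simp: xs_def)
  have "length xs \<le> m"
    using assms by (simp add: xs_def)
  have "(\<Sum>c<m. f (\<beta> c)) = real p * f a + real q * f b + real x * f u + real y * f v"
    if "f 0 = 0" for f :: "nat \<Rightarrow> real"
  proof -
    have "(\<Sum>c<m. f (\<beta> c)) = (\<Sum>c<length xs. f (\<beta> c))"
      using \<open>length xs \<le> m\<close> that by (intro sum.mono_neutral_right) (auto simp: \<beta>_def)
    also have "\<dots> = sum_list (map f xs)"
      by (simp add: sum_list_sum_nth \<beta>_def atLeast0LessThan)
    also have "\<dots> = real p * f a + real q * f b + real x * f u + real y * f v"
      by (simp add: xs_def sum_list_replicate)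
    finally show ?thesis .
  qed
  moreover have "\<beta> c \<in> {a, b, u, v, 0}" for c
  proof (cases "c < length xs")
    case True
    then have "\<beta> c \<in> {a, b, u, v}"
      using subsetD[OF set nth_mem[OF True]] by (simp add: \<beta>_def)
    then show ?thesis by blast
  qed (simp add: \<beta>_def)
  ultimately show ?thesis using that by blast
qed

text \<open>
  The hypothesis \<open>half\<close> expresses that \<open>j\<close> is close to \<open>d / 2\<close>; it turns the lower bound on \<open>m k\<close> into one
  on \<open>B - D = e j (d - j)\<close>. The room for all cliques comes from
  \<open>m k (k - 1) - k B + D = (k - 2) e d (d - j) + e (d - j)\<^sup>2\<close>, in which the first summand is already at
  least \<open>(k - 2) (B - D)\<close>. The hypothesis \<open>parity\<close> makes \<open>D\<close> even if \<open>k\<close> is even, and \<open>B - D\<close> even if \<open>k\<close>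
  is odd, since \<open>j (d - j)\<close> is even for odd \<open>d\<close>.
\<close>

lemma friendship_not_maximal_if_square_divides:
  fixes k m d e j :: nat
  assumes k: "2 \<le> k" and m: "1 \<le> m" and n: "m * k = d\<^sup>2 * e" and j: "0 < j" "j < d"
    and half: "2 * d\<^sup>2 \<le> 9 * (j * (d - j))"
    and parity: "even e \<or> odd d \<and> odd k"
    and large: "(5 * int k ^ 2 - 19 * int k + 20)\<^sup>2 \<le> 4 * int (m * k)"
  shows "\<not> maximal_reduced (generalized_friendship_graph k m)"
proof -
  define B D where "B = int (d * e * j)" and "D = int (e * j\<^sup>2)"
  have BD: "B - D = int e * (int j * (int d - int j))"
    by (simp add: B_def D_def power2_eq_square algebra_simps)
  have e: "0 < e"
    using n k m by (metis gr0I mult_is_0 not_one_le_zero rel_simps(51) zero_less_numeral le_zero_eq)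
  have n': "int m * int k = (int d)\<^sup>2 * int e"
    using n by (metis of_nat_mult of_nat_power)
  have "int (2 * d\<^sup>2) \<le> int (9 * (j * (d - j)))"
    using half by (simp only: of_nat_le_iff)
  then have "2 * (int d)\<^sup>2 \<le> 9 * (int j * (int d - int j))"
    using j by (simp add: of_nat_diff)
  then have "int e * (2 * (int d)\<^sup>2) \<le> int e * (9 * (int j * (int d - int j)))"
    by (rule mult_left_mono) simp
  then have "2 * (int m * int k) \<le> 9 * (B - D)"
    unfolding n' BD by (simp only: mult_ac)
  then have big: "(5 * (int k)\<^sup>2 - 19 * int k + 20)\<^sup>2 \<le> 18 * (B - D)"
    using large by simp
  have "int j * (int d - int j) \<le> int d * (int d - int j)"
    using j by (intro mult_right_mono) auto
  then have "(int k - 2) * (B - D) \<le> (int k - 2) * (int e * (int d * (int d - int j)))"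
    using k unfolding BD by (intro mult_left_mono) auto
  also have "\<dots> \<le> (int k - 2) * (int e * (int d * (int d - int j))) + int e * (int d - int j)\<^sup>2"
    by simp
  also have "\<dots> = (int m * int k) * (int k - 1) - int k * B + D"
    unfolding n' by (simp add: B_def D_def power2_eq_square algebra_simps)
  finally have room: "(int k - 2) * (B - D) \<le> (int m * int k) * (int k - 1) - int k * B + D" .
  have par: "even (int k) \<longrightarrow> even D" "odd (int k) \<longrightarrow> even (B - D)"
    unfolding BD using parity by (auto simp: D_def)
  have k': "2 \<le> int k" and D0: "0 \<le> D"
    using k by (simp_all add: D_def)
  obtain p q x y :: int where pq: "0 \<le> p" "0 \<le> q" "0 \<le> x" "0 \<le> y" "p + q + x + y \<le> m"
    "p * k + q * (int k - 1) + x + y * (int k - 2) = B" "p * k - (x + y) * (int k - 2) = D"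
    by (rule clique_count_multiplicities[OF k' D0 par big room])
  have cnt: "nat p + nat q + nat x + nat y \<le> m"
    using pq(1-5) by linarith
  obtain \<beta> where \<beta>: "\<And>c. \<beta> c \<in> {k, k - 1, 1, k - 2, 0}"
    "\<And>f :: nat \<Rightarrow> real. f 0 = 0 \<Longrightarrow> (\<Sum>c<m. f (\<beta> c))
       = real (nat p) * f k + real (nat q) * f (k - 1) + real (nat x) * f 1 + real (nat y) * f (k - 2)"
    using exists_function_with_multiplicities[OF cnt] by metis
  have kk: "real (k - Suc 0) = real k - 1" "real (k - 2) = real k - 2"
    using k by (simp_all add: of_nat_diff)
  have "\<beta> c \<le> k" for c
    using \<beta>(1)[of c] k by auto
  moreover have sumB: "(\<Sum>c<m. real (\<beta> c)) = of_int B"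
    using \<beta>(2)[of real] pq(1-4) by (simp add: kk flip: pq(6))
  moreover have sumD: "(\<Sum>c<m. real (\<beta> c) * (real (\<beta> c) - (real k - 1))) = of_int D"
    using \<beta>(2)[of "\<lambda>b. real b * (real b - (real k - 1))"] pq(1-4)
    by (simp add: kk algebra_simps flip: pq(7))
  moreover have "0 < B" "B < int (m * k)"
    using j e by (auto simp: B_def n power2_eq_square)
  moreover have "B\<^sup>2 = int (m * k) * D"
    unfolding n B_def D_def by (simp add: power2_eq_square algebra_simps)
  then have "(real_of_int B)\<^sup>2 = real (m * k) * of_int D"
    by (metis of_int_mult of_int_of_nat_eq of_int_power)
  moreover have "0 < real_of_int B" "real_of_int B < real (m * k)"
    using \<open>0 < B\<close> \<open>B < int (m * k)\<close> by linarith+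
  ultimately show ?thesis
    using friendship_not_maximal_if_clique_counts[OF k m, of \<beta> "of_int B"] by simp
qed

theorem theorem10:
  fixes k m :: nat
  assumes "k \<ge> 2" and "m \<ge> 1"
    and "(\<exists>d::nat. odd d \<and> d > 1 \<and> d ^ 2 dvd m * k) \<or> 8 dvd m * k"
    and "real m \<ge> (5 * real k ^ 2 - 19 * real k + 20) ^ 2 / (4 * real k)"
  shows "\<not> maximal_reduced (generalized_friendship_graph k m)"
proof -
  have "(5 * real k ^ 2 - 19 * real k + 20)\<^sup>2 \<le> 4 * real (m * k)"
    using assms(1,4) by (simp add: field_simps)
  then have "real_of_int ((5 * int k ^ 2 - 19 * int k + 20)\<^sup>2) \<le> real_of_int (4 * int (m * k))"
    by simp
  then have large: "(5 * int k ^ 2 - 19 * int k + 20)\<^sup>2 \<le> 4 * int (m * k)"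
    by (simp only: of_int_le_iff)
  from assms(3) show ?thesis
  proof
    assume "\<exists>d::nat. odd d \<and> d > 1 \<and> d ^ 2 dvd m * k"
    then obtain d e where d: "odd d" "d > 1" and n: "m * k = d\<^sup>2 * e"
      by (auto elim!: dvdE)
    \<comment> \<open>The constants \<open>2\<close> and \<open>9\<close> in the requirement on \<open>j\<close> are sharp for \<open>d = 3\<close>, \<open>j = 1\<close>.\<close>
    obtain j where j: "d = 2 * j + 1" using d(1) by (elim oddE)
    then have "1 \<le> j" using d(2) by simp
    then have "2 \<le> j + j * j"
      using mult_le_mono[of 1 j 1 j] by linarith
    then have "2 * d\<^sup>2 \<le> 9 * (j * (d - j))"
      by (simp add: j power2_eq_square algebra_simps)
    moreover have "even e \<or> odd d \<and> odd k"
      using n d(1) by (metis even_mult_iff even_power)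
    ultimately show ?thesis
      using friendship_not_maximal_if_square_divides[OF assms(1,2) n, of j] \<open>1 \<le> j\<close> large by (simp add: j)
  next
    assume "8 dvd m * k"
    then obtain r where "m * k = 2\<^sup>2 * (2 * r)" by (auto elim!: dvdE)
    then show ?thesis
      using friendship_not_maximal_if_square_divides[OF assms(1,2), of 2 "2 * r" 1] large by simp
  qed
qed

end
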